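(* For all $n\ge 7$, the total number $S(n)$ of strict superpatterns for $[3]^3$ of length $n$ is $$S(n)=6\sum_{m=7}^{n}\left[(m-4)^2-2\right]\binom{n-2}{m-2}.$$ Consequently, if $\{X_i\}_{i=1}^\infty$ is a sequence of independent random variables, each uniformly distributed on $\{1,2,3\}$, and $\tau=\inf\{t\ge 7:\ X_1X_2\cdots X_t \text{ is a superpattern for } [3]^3\}$, then for all $n\ge 7$ $$\mathbb{P}(\tau=n)=\frac{6}{3^n}\sum_{m=7}^{n}\left[(m-4)^2-2\right]\binom{n-2}{m-2}.$$
   Context: Words are finite strings over the alphabet $[3]=\{1,2,3\}$. The preferential arrangements of length 3 are the 13 words $111, 112, 121, 211, 122, 212, 221, 123, 132, 213, 231, 312, 321$. A word $w=w_1\cdots w_n$ contains a preferential arrangement $p=p_1p_2p_3$ if there are indices $a_1<a_2<a_3$ such that $w_{a_1}w_{a_2}w_{a_3}$ is order-isomorphic to $p$, i.e. for all $s,t$, $w_{a_s}<w_{a_t}$ if and only if $p_s<p_t$ (so equal letters correspond to equal letters). A superpattern for $[3]^3$ is a word over $[3]$ that contains all 13 preferential arrangements of length 3. A strict superpattern is a superpattern whose last letter is needed to complete one of the preferential arrangements, i.e. deleting the last letter yields a word that is not a superpattern. *)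

theory Defs
  imports "HOL-Probability.Probability"
begin

text \<open>Words are lists of natural numbers, indexed from 0.\<close>

definition pref_arrangements :: "nat list set" where
  "pref_arrangements =
     {[1,1,1], [1,1,2], [1,2,1], [2,1,1], [1,2,2], [2,1,2], [2,2,1],
      [1,2,3], [1,3,2], [2,1,3], [2,3,1], [3,1,2], [3,2,1]}"

definition contains_pattern :: "nat list \<Rightarrow> nat list \<Rightarrow> bool" where
  "contains_pattern w p \<longleftrightarrow>
     (\<exists>a. strict_mono_on {..<length p} a \<and> (\<forall>s<length p. a s < length w) \<and>
        (\<forall>s<length p. \<forall>t<length p. w ! a s < w ! a t \<longleftrightarrow> p ! s < p ! t))"

definition superpattern :: "nat list \<Rightarrow> bool" where
  "superpattern w \<longleftrightarrow> set w \<subseteq> {1,2,3} \<and> (\<forall>p\<in>pref_arrangements. contains_pattern w p)"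

definition strict_superpattern :: "nat list \<Rightarrow> bool" where
  "strict_superpattern w \<longleftrightarrow> superpattern w \<and> \<not> superpattern (butlast w)"

definition num_strict_superpatterns :: "nat \<Rightarrow> nat" where
  "num_strict_superpatterns n = card {w. length w = n \<and> strict_superpattern w}"

text \<open>The infimum is taken in \<^typ>\<open>enat\<close>, so the waiting time is \<open>\<infinity>\<close> on outcomes for
  which no prefix is a superpattern. The letters are \<open>X 1, X 2, \<dots>\<close>; \<open>X 0\<close> is not used.\<close>

definition waiting_time :: "(nat \<Rightarrow> 'a \<Rightarrow> nat) \<Rightarrow> 'a \<Rightarrow> enat" where
  "waiting_time X \<omega> = (INF t\<in>{t. t \<ge> 7 \<and> superpattern (map (\<lambda>i. X i \<omega>) [1..<Suc t])}. enat t)"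

end

theory Submission
  imports Defs "HOL-Library.Sublist"
begin

text \<open>
  Over three letters, the six patterns without a repeated letter can only be realised by
  themselves, as subsequences, and a word that has all six of them as subsequences contains the
  seven patterns with a repeated letter as well (\<open>superpattern_iff_arrangements\<close>). The condition is
  therefore symmetric under permutations of the alphabet, and reading the same letter twice in a
  row is no better than reading it once.

  Now read a word from left to right. After the first letter \<open>a\<close> has been seen, the patterns that
  start with \<open>a\<close> ask that the rest of the word, restricted to the other two letters, alternates at
  least twice, that is, consists of at least three blocks. What is still needed after a prefix is
  thus described by which letter was read last, which different letter was read before it, and by
  how many blocks are missing for each letter, if it has been seen. Up to renaming the letters only
  fifteen stages are reachable. A repeated letter leaves the stage unchanged, and either of the other two
  letters changes it in a definite way (\<open>meets_needs_Cons\<close>).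

  Collapsing each block of equal letters to a single letter separates the count into two factors. A
  strict superpattern of length \<open>n\<close> with \<open>m\<close> blocks has a last block of length 1, so the block
  lengths can be chosen in \<open>(n - 2) choose (m - 2)\<close> ways. The collapsed words of
  length \<open>m\<close> correspond to paths through the stages. All cycles among the reachable stages come from
  going back and forth between two letters, so the numbers of paths are polynomials in the length: six choices of the first two
  letters, each with \<open>(m - 4)\<^sup>2 - 2\<close> completions if \<open>m \<ge> 7\<close> and none otherwise
  (\<open>routes_Two\<close>, \<open>routes_Two_less\<close>).

  For independent uniform letters every word of length \<open>n\<close> has probability \<open>1 / 3 ^ n\<close>, and the
  waiting time is \<open>n\<close> exactly when the first \<open>n\<close> letters form a strict superpattern. For
  \<open>n = 7\<close> this uses that there is no shorter superpattern, which the same count shows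
  (\<open>superpattern_length_ge_7\<close>).
\<close>


section \<open>Patterns as subsequences\<close>

lemma subseq_iff_strict_mono_index:
  "subseq q w \<longleftrightarrow>
     (\<exists>a. strict_mono_on {..<length q} a \<and> (\<forall>s<length q. a s < length w \<and> w ! a s = q ! s))"
  (is "_ \<longleftrightarrow> (\<exists>a. ?emb q w a)")
proof
  assume "subseq q w"
  then show "\<exists>a. ?emb q w a"
  proof (induction rule: list_emb.induct)
    case (list_emb_Nil w)
    show ?case by (auto simp: strict_mono_on_def)
  next
    case (list_emb_Cons q w x)
    then obtain a where "?emb q w a" by blast
    then have "?emb q (x # w) (\<lambda>s. Suc (a s))" by (auto simp: strict_mono_on_def)
    then show ?case by blast
  next
    case (list_emb_Cons2 x y q w)
    then obtain a where "?emb q w a" by blast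
    then have "?emb (x # q) (y # w) (\<lambda>s. case s of 0 \<Rightarrow> 0 | Suc t \<Rightarrow> Suc (a t))"
      using list_emb_Cons2 by (auto simp: strict_mono_on_def split: nat.splits)
    then show ?case by blast
  qed
next
  assume "\<exists>a. ?emb q w a"
  then obtain a where a: "?emb q w a" by blast
  then show "subseq q w"
  proof (induction w arbitrary: q a)
    case Nil
    then show ?case by (cases q) auto
  next
    case (Cons x w)
    show ?case
    proof (cases q)
      case Nil
      then show ?thesis by simp
    next
      case q: (Cons y r)
      note mono = conjunct1[OF Cons.prems] and idx = conjunct2[OF Cons.prems]
      have pos: "a (Suc s) > 0" if "s < length r" for s
        using strict_mono_onD[OF mono, of 0 "Suc s"] that q by auto
      have tail: "?emb r w (\<lambda>s. a (Suc s) - 1)"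
      proof (intro conjI allI impI)
        show "strict_mono_on {..<length r} (\<lambda>s. a (Suc s) - 1)"
        proof (rule strict_mono_onI)
          fix s t assume "s \<in> {..<length r}" "t \<in> {..<length r}" "s < t"
          then show "a (Suc s) - 1 < a (Suc t) - 1"
            using strict_mono_onD[OF mono, of "Suc s" "Suc t"] pos[of s] q by auto
        qed
        fix s assume s: "s < length r"
        then have "a (Suc s) < Suc (length w)" "(x # w) ! a (Suc s) = r ! s"
          using idx q by auto
        then show "a (Suc s) - 1 < length w" "w ! (a (Suc s) - 1) = r ! s"
          using pos[OF s] by (auto simp: nth_Cons')
      qed
      show ?thesis
      proof (cases "a 0")
        case 0
        then have "x = y" using idx q by auto
        then show ?thesis using Cons.IH[OF tail] q by simp
      next
        case (Suc k)
        have pos': "a s > 0" if "s < length q" for s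
          using pos Suc q that by (cases s) auto
        have "?emb q w (\<lambda>s. a s - 1)"
        proof (intro conjI allI impI)
          show "strict_mono_on {..<length q} (\<lambda>s. a s - 1)"
          proof (rule strict_mono_onI)
            fix s t assume "s \<in> {..<length q}" "t \<in> {..<length q}" "s < t"
            then show "a s - 1 < a t - 1"
              using strict_mono_onD[OF mono, of s t] pos'[of s] by auto
          qed
          fix s assume s: "s < length q"
          then have "a s < Suc (length w)" "(x # w) ! a s = q ! s"
            using idx by auto
          then show "a s - 1 < length w" "w ! (a s - 1) = q ! s"
            using pos'[OF s] by (auto simp: nth_Cons')
        qed
        from Cons.IH[OF this] show ?thesis by (rule list_emb_Cons)
      qed
    qed
  qed
qed

definition order_isomorphic :: "nat list \<Rightarrow> nat list \<Rightarrow> bool" where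
  "order_isomorphic q p \<longleftrightarrow> length q = length p \<and>
     (\<forall>s<length p. \<forall>t<length p. q ! s < q ! t \<longleftrightarrow> p ! s < p ! t)"

lemma contains_pattern_iff_subseq:
  "contains_pattern w p \<longleftrightarrow> (\<exists>q. order_isomorphic q p \<and> subseq q w)"
proof
  assume "contains_pattern w p"
  then obtain a where a: "strict_mono_on {..<length p} a" "\<forall>s<length p. a s < length w"
    "\<forall>s<length p. \<forall>t<length p. w ! a s < w ! a t \<longleftrightarrow> p ! s < p ! t"
    unfolding contains_pattern_def by blast
  let ?q = "map (\<lambda>s. w ! a s) [0..<length p]"
  have "order_isomorphic ?q p" using a by (simp add: order_isomorphic_def)
  moreover have "subseq ?q w"
    unfolding subseq_iff_strict_mono_index using a by (intro exI[of _ a]) simp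
  ultimately show "\<exists>q. order_isomorphic q p \<and> subseq q w" by blast
next
  assume "\<exists>q. order_isomorphic q p \<and> subseq q w"
  then obtain q a where "order_isomorphic q p" "strict_mono_on {..<length q} a"
    "\<forall>s<length q. a s < length w \<and> w ! a s = q ! s"
    unfolding subseq_iff_strict_mono_index by blast
  then show "contains_pattern w p"
    unfolding contains_pattern_def order_isomorphic_def by (intro exI[of _ a]) auto
qed

lemma order_isomorphic_triple:
  "order_isomorphic q [i, j, k] \<longleftrightarrow>
     (\<exists>x y z. q = [x, y, z] \<and> (x < y \<longleftrightarrow> i < j) \<and> (y < x \<longleftrightarrow> j < i) \<and> (x < z \<longleftrightarrow> i < k)
        \<and> (z < x \<longleftrightarrow> k < i) \<and> (y < z \<longleftrightarrow> j < k) \<and> (z < y \<longleftrightarrow> k < j))"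
proof (cases "length q = 3")
  case True
  then obtain x y z where q: "q = [x, y, z]" by (auto simp: length_Suc_conv numeral_3_eq_3)
  show ?thesis
    unfolding order_isomorphic_def q by (simp add: All_less_Suc2) blast
next
  case False
  then show ?thesis by (auto simp: order_isomorphic_def)
qed

lemma contains_patternI:
  "subseq [x, y, z] w \<Longrightarrow> order_isomorphic [x, y, z] p \<Longrightarrow> contains_pattern w p"
  unfolding contains_pattern_iff_subseq by blast


section \<open>Superpatterns are the words containing all six permutations\<close>

definition arrangements :: "'a \<Rightarrow> 'a \<Rightarrow> 'a \<Rightarrow> 'a list set" where
  "arrangements x y z = {[x,y,z], [x,z,y], [y,x,z], [y,z,x], [z,x,y], [z,y,x]}"

definition meets :: "'a list set \<Rightarrow> 'a list \<Rightarrow> bool" where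
  "meets Q w \<longleftrightarrow> (\<forall>q\<in>Q. subseq q w)"

lemma meets_mono: "meets Q v \<Longrightarrow> subseq v w \<Longrightarrow> meets Q w"
  unfolding meets_def by (blast intro: subseq_order.trans)

lemma contains_pattern_permutation:
  assumes "set w \<subseteq> {1, 2, 3}" "p \<in> arrangements 1 2 3"
  shows "contains_pattern w p \<longleftrightarrow> subseq p w"
proof
  assume "contains_pattern w p"
  then obtain q where q: "order_isomorphic q p" "subseq q w"
    unfolding contains_pattern_iff_subseq by blast
  have sub: "set q \<subseteq> {1, 2, 3}"
  proof
    fix x assume "x \<in> set q"
    then obtain y where "y \<in> set w" "x = y" using list_emb_set[OF q(2)] by blast
    with assms(1) show "x \<in> {1, 2, 3}" by blast
  qed
  have "q = p"
    using assms(2) q(1) sub by (auto simp: arrangements_def order_isomorphic_triple)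
  with q show "subseq p w" by simp
next
  assume "subseq p w"
  moreover have "order_isomorphic p p" by (simp add: order_isomorphic_def)
  ultimately show "contains_pattern w p" unfolding contains_pattern_iff_subseq by blast
qed

text \<open>The first alternative expresses that \<open>y\<close> occurs before the first \<open>x\<close>, in the form in which it
  is used: a subsequence that starts with \<open>x\<close> can be extended by \<open>y\<close> in front. Of two letters, one
  always occurs before the other does.\<close>

lemma first_occurrence_cases:
  assumes "x \<noteq> y"
  shows "(\<forall>r. subseq (x # r) w \<longrightarrow> subseq (y # x # r) w) \<or>
         (\<forall>r. subseq (y # r) w \<longrightarrow> subseq (x # y # r) w)"
proof (induction w)
  case Nil
  then show ?case by simp
next
  case (Cons a w)
  then show ?case using assms by (cases "a = x"; cases "a = y") auto
qed

lemma merge_heads: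
  assumes "subseq (x # r) w" "subseq (y # s) w" "x \<noteq> y"
  shows "subseq (x # y # s) w \<or> subseq (y # x # r) w"
  using first_occurrence_cases[OF assms(3), of w] assms(1,2) by blast

lemma suffix_after_first:
  "subseq [x] w \<Longrightarrow> \<exists>v. \<forall>r. subseq (x # r) w \<longleftrightarrow> subseq r v"
proof (induction w)
  case (Cons a w)
  then show ?case by (cases "a = x") auto
qed simp

text \<open>Once \<open>u\<close> has occurred, only the suffix after its first occurrence matters, and there the
  heads \<open>x\<close> and \<open>y\<close> can be merged.\<close>

lemma merge_second:
  assumes "subseq (u # x # r) w" "subseq (u # y # s) w" "x \<noteq> y"
  shows "subseq (u # x # y # s) w \<or> subseq (u # y # x # r) w"
proof -
  have "subseq [u] w" using assms(1) by (rule subseq_order.trans[rotated]) simp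
  then obtain v where v: "\<forall>r. subseq (u # r) w \<longleftrightarrow> subseq r v"
    by (rule exE[OF suffix_after_first])
  show ?thesis using merge_heads[of x r v y s] assms by (simp add: v)
qed

text \<open>Let \<open>t\<close> be the letter whose first occurrence comes last. After it, \<open>a b\<close> and \<open>b a\<close> both
  occur, hence \<open>a b a\<close> or \<open>b a b\<close>. The letter that appears twice there has already appeared before
  \<open>t\<close>, so it appears three times.\<close>

lemma arrangements_imp_letter_thrice:
  assumes m: "meets (arrangements x y z) w" and distinct: "x \<noteq> y" "x \<noteq> z" "y \<noteq> z"
  shows "\<exists>a. subseq [a, a, a] w"
proof -
  define before where
    "before b a \<longleftrightarrow> (\<forall>r. subseq (a # r) w \<longrightarrow> subseq (b # a # r) w)" for a b
  have trans: "before b a" if "before b c" "before c a" for a b c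
    unfolding before_def
  proof (intro allI impI)
    fix r assume "subseq (a # r) w"
    then have "subseq (c # a # r) w" by (rule that(2)[unfolded before_def, rule_format])
    then have "subseq (b # c # a # r) w" by (rule that(1)[unfolded before_def, rule_format])
    then show "subseq (b # a # r) w"
      by (rule subseq_order.trans[rotated]) (auto intro: list_emb_Cons)
  qed
  have thrice: "\<exists>a. subseq [a, a, a] w"
    if "subseq [t, a, b] w" "subseq [t, b, a] w" "before a t" "before b t" "a \<noteq> b" for a b t
  proof -
    have "subseq [t, a, b, a] w \<or> subseq [t, b, a, b] w"
      using merge_second[OF that(1,2,5)] .
    then have "subseq [a, t, a, b, a] w \<or> subseq [b, t, b, a, b] w"
      using that(3,4) unfolding before_def by blast
    moreover have "subseq [a, a, a] [a, t, a, b, a]" "subseq [b, b, b] [b, t, b, a, b]" by auto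
    ultimately show ?thesis using subseq_order.trans[of _ _ w] by blast
  qed
  have "before y x \<or> before x y" "before z x \<or> before x z" "before z y \<or> before y z"
    unfolding before_def using distinct by (simp_all only: first_occurrence_cases not_False_eq_True)
  \<comment> \<open>Some letter comes last; the two cyclic orders are excluded by transitivity.\<close>
  then consider "before y x" "before z x" | "before x y" "before z y" | "before x z" "before y z"
    using trans[where a = x and b = z and c = y] trans[where a = z and b = x and c = y] by argo
  moreover have sub: "subseq [x,y,z] w" "subseq [x,z,y] w" "subseq [y,x,z] w" "subseq [y,z,x] w"
    "subseq [z,x,y] w" "subseq [z,y,x] w"
    using m by (auto simp: meets_def arrangements_def)
  ultimately show ?thesis
  proof cases
    case 1
    show ?thesis by (rule thrice[OF sub(1,2) 1 distinct(3)])
  next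
    case 2
    show ?thesis by (rule thrice[OF sub(3,4) 2 distinct(2)])
  next
    case 3
    show ?thesis by (rule thrice[OF sub(5,6) 3 distinct(1)])
  qed
qed

text \<open>Two permutations merge, at the first position where they differ, into one of two words of
  length 4, and both of these contain the same pattern with a repeated letter, if the two permutations
  are chosen suitably. For instance \<open>123\<close> and \<open>213\<close> give \<open>1213\<close> or
  \<open>2123\<close>, hence \<open>113\<close> or \<open>223\<close>, and each of them is an instance of \<open>112\<close>.\<close>

lemma superpattern_iff_arrangements:
  "superpattern w \<longleftrightarrow> set w \<subseteq> {1, 2, 3} \<and> meets (arrangements 1 2 3) w"
proof (intro iffI conjI)
  assume "superpattern w"
  then show letters: "set w \<subseteq> {1, 2, 3}" by (simp add: superpattern_def)
  have "arrangements 1 2 3 \<subseteq> pref_arrangements"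
    by (auto simp: arrangements_def pref_arrangements_def)
  then show "meets (arrangements 1 2 3) w"
    using \<open>superpattern w\<close> contains_pattern_permutation[OF letters]
    by (auto simp: superpattern_def meets_def)
next
  assume R: "set w \<subseteq> {1, 2, 3} \<and> meets (arrangements 1 2 3) w"
  then have sub: "subseq [1,2,3] w" "subseq [1,3,2] w" "subseq [2,1,3] w" "subseq [2,3,1] w"
    "subseq [3,1,2] w" "subseq [3,2,1] w"
    by (auto simp: meets_def arrangements_def)
  have perms: "contains_pattern w p" if "p \<in> arrangements 1 2 3" for p
    using contains_pattern_permutation[of w p] R that by (auto simp: meets_def)
  have weaken: "contains_pattern w p"
    if "subseq u w \<or> subseq v w" "subseq [a,b,c] u" "subseq [d,e,f] v"
      "order_isomorphic [a,b,c] p" "order_isomorphic [d,e,f] p" for u v p a b c d e f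
    using that(1)
  proof
    assume "subseq u w"
    with that(2) have "subseq [a,b,c] w" by (rule subseq_order.trans)
    then show ?thesis using that(4) by (rule contains_patternI)
  next
    assume "subseq v w"
    with that(3) have "subseq [d,e,f] w" by (rule subseq_order.trans)
    then show ?thesis using that(5) by (rule contains_patternI)
  qed
  have "contains_pattern w [1,1,2]"
    using merge_heads[OF sub(1,3)]
    by (rule weaken[of _ _ 1 1 3 2 2 3]) (auto simp: order_isomorphic_triple)
  moreover have "contains_pattern w [2,2,1]"
    using merge_heads[OF sub(4,6)]
    by (rule weaken[of _ _ 2 2 1 3 3 1]) (auto simp: order_isomorphic_triple)
  moreover have "contains_pattern w [1,2,1]"
    using merge_heads[OF sub(2,3)]
    by (rule weaken[of _ _ 1 2 1 2 3 2]) (auto simp: order_isomorphic_triple)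
  moreover have "contains_pattern w [2,1,2]"
    using merge_heads[OF sub(4,5)]
    by (rule weaken[of _ _ 2 1 2 3 2 3]) (auto simp: order_isomorphic_triple)
  moreover have "contains_pattern w [1,2,2]"
    using merge_second[OF sub(1,2)]
    by (rule weaken[of _ _ 1 2 2 1 3 3]) (auto simp: order_isomorphic_triple)
  moreover have "contains_pattern w [2,1,1]"
    using merge_second[OF sub(5,6)]
    by (rule weaken[of _ _ 3 1 1 3 2 2]) (auto simp: order_isomorphic_triple)
  moreover have "contains_pattern w [1,1,1]"
  proof -
    obtain a where "subseq [a, a, a] w"
      using arrangements_imp_letter_thrice[of 1 2 3 w] R by auto
    then show ?thesis by (rule contains_patternI) (simp add: order_isomorphic_triple)
  qed
  ultimately show "superpattern w"
    using R perms by (simp add: superpattern_def pref_arrangements_def arrangements_def)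
qed


section \<open>Counting the words at whose end a property first holds\<close>

definition first_hits :: "'a set \<Rightarrow> ('a list \<Rightarrow> bool) \<Rightarrow> nat \<Rightarrow> 'a list set" where
  "first_hits A P n = {w. length w = n \<and> set w \<subseteq> A \<and> P w \<and> (\<forall>k<n. \<not> P (take k w))}"

lemma finite_first_hits: "finite A \<Longrightarrow> finite (first_hits A P n)"
  unfolding first_hits_def
  by (rule finite_subset[OF _ finite_lists_length_eq[of A n]]) auto

lemma card_first_hits_0: "card (first_hits A P 0) = (if P [] then 1 else 0)"
proof -
  have "first_hits A P 0 = (if P [] then {[]} else {})" by (auto simp: first_hits_def)
  then show ?thesis by simp
qed

text \<open>Reading the first letter \<open>a\<close> replaces the property by its derivative with respect to \<open>a\<close>.\<close>

lemma card_first_hits_Suc: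
  assumes "finite A"
  shows "card (first_hits A P (Suc n)) =
    (if P [] then 0 else \<Sum>a\<in>A. card (first_hits A (\<lambda>w. P (a # w)) n))"
proof (cases "P []")
  case True
  then have "first_hits A P (Suc n) = {}" by (auto simp: first_hits_def)
  with True show ?thesis by simp
next
  case False
  have "first_hits A P (Suc n) = (\<Union>a\<in>A. (#) a ` first_hits A (\<lambda>w. P (a # w)) n)"
    using False
    by (auto simp: first_hits_def length_Suc_conv All_less_Suc2 image_iff)
  also have "card \<dots> = (\<Sum>a\<in>A. card ((#) a ` first_hits A (\<lambda>w. P (a # w)) n))"
    by (rule card_UN_disjoint) (auto simp: assms finite_first_hits)
  also have "\<dots> = (\<Sum>a\<in>A. card (first_hits A (\<lambda>w. P (a # w)) n))"
    by (intro sum.cong card_image) (auto simp: inj_on_def)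
  finally show ?thesis using False by simp
qed


section \<open>What is still needed after a prefix\<close>

fun alternating :: "nat \<Rightarrow> 'a \<Rightarrow> 'a \<Rightarrow> 'a list" where
  "alternating 0 a b = []"
| "alternating (Suc k) a b = a # alternating k b a"

text \<open>
  A stage records how far the reading has come, up to the names of the letters. Let \<open>c\<close> be the
  letter read last, \<open>p\<close> the letter different from \<open>c\<close> read most recently before it, and \<open>q\<close> the
  third letter. In stage \<open>Gaps i j k\<close> what has been read after the first \<open>p\<close>, restricted to \<open>c\<close>
  and \<open>q\<close>, lacks \<open>i\<close> of the three blocks, and \<open>j\<close> and \<open>k\<close> count in the same way for \<open>c\<close> and \<open>q\<close>. Among
  the letters other than \<open>p\<close> the last block consists of \<open>c\<close>, so the missing ones alternate
  starting with \<open>q\<close>; similarly for the other two.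

  The other stages are those where some letter is unseen or has just been read for the first time, so
  that for this letter both orders of the remaining two are still to come. In \<open>One\<close> a single letter
  has been seen, in \<open>Two\<close> and \<open>Two_Repeated\<close> two letters, in \<open>Two\<close> with a single change between
  them so far. In \<open>Third_Early\<close> and \<open>Third_Late\<close> the third letter has just been read for the first
  time, coming from \<open>Two\<close> and from \<open>Two_Repeated\<close>, respectively. The sets \<open>needs\<close> of these
  stages leave out some words that are subsequences of other required words.
\<close>

datatype stage = One | Two | Two_Repeated | Third_Early | Third_Late | Gaps nat nat nat

fun needs :: "stage \<Rightarrow> 'a \<Rightarrow> 'a \<Rightarrow> 'a \<Rightarrow> 'a list set" where
  "needs One p c q = {[p,q], [q,p], [p,c,q], [p,q,c], [q,c,p], [q,p,c]}"
| "needs Two p c q = {[q,p,c], [q,c,p], [p,q]}"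
| "needs Two_Repeated p c q = {[q,p,c], [q,c,p]}"
| "needs Third_Early p c q = {[q,c], [q,p], [p,q]}"
| "needs Third_Late p c q = {[q,p], [p,q]}"
| "needs (Gaps i j k) p c q = {alternating i q c, alternating j q p, alternating k p c}"

text \<open>Reading \<open>p\<close>, the letter before the current one, exchanges the roles of \<open>p\<close> and \<open>c\<close>.\<close>

fun turn :: "stage \<Rightarrow> stage" where
  "turn One = Two"
| "turn Two = Two_Repeated"
| "turn Two_Repeated = Two_Repeated"
| "turn Third_Early = Gaps 2 2 0"
| "turn Third_Late = Gaps 2 1 0"
| "turn (Gaps i j k) = Gaps j i (k - 1)"

text \<open>Reading the third letter \<open>q\<close> makes \<open>(c, q, p)\<close> the new triple of roles.\<close>

fun advance :: "stage \<Rightarrow> stage" where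
  "advance One = Two"
| "advance Two = Third_Early"
| "advance Two_Repeated = Third_Late"
| "advance Third_Early = Gaps 2 1 1"
| "advance Third_Late = Gaps 2 1 0"
| "advance (Gaps i j k) = Gaps (j - 1) k (i - 1)"

abbreviation complete :: stage where
  "complete \<equiv> Gaps 0 0 0"

lemma subseq_alternating_Cons_same:
  "subseq (alternating k a b) (a # w) \<longleftrightarrow> subseq (alternating (k - 1) b a) w"
  by (cases k) auto

lemma subseq_alternating_Cons_other:
  "x \<noteq> a \<Longrightarrow> subseq (alternating k a b) (x # w) \<longleftrightarrow> subseq (alternating k a b) w"
  by (cases k) auto

lemma meets_needs_Nil: "meets (needs s p c q) [] \<longleftrightarrow> s = complete"
proof -
  have "subseq (alternating k a b) [] \<longleftrightarrow> k = 0" for k and a b :: 'a by (cases k) auto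
  then show ?thesis by (cases s) (auto simp: meets_def)
qed

text \<open>No required word starts with the current letter \<open>c\<close> (an earlier \<open>c\<close> would have served
  equally well), so repeating it changes nothing. For the other two letters the required words are
  shortened where they start with the letter, and the result is the set of the next stage, up to words
  that have become redundant.\<close>

lemma meets_needs_Cons:
  assumes "p \<noteq> c" "p \<noteq> q" "c \<noteq> q"
  shows "meets (needs s p c q) (c # w) \<longleftrightarrow> meets (needs s p c q) w"
    and "meets (needs s p c q) (p # w) \<longleftrightarrow> meets (needs (turn s) c p q) w"
    and "meets (needs s p c q) (q # w) \<longleftrightarrow> meets (needs (advance s) c q p) w"
proof -
  have drop: "subseq (x # r) w \<Longrightarrow> subseq r w" for x :: 'a and r
    by (rule subseq_Cons')
  have drop2: "subseq (x # y # r) w \<Longrightarrow> subseq (x # r) w" for x y :: 'a and r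
    by (rule subseq_order.trans[rotated]) auto
  note simps = meets_def subseq_alternating_Cons_same subseq_alternating_Cons_other
    numeral_2_eq_2
  show "meets (needs s p c q) (c # w) \<longleftrightarrow> meets (needs s p c q) w"
    using assms by (cases s) (auto simp: simps dest: drop drop2)
  show "meets (needs s p c q) (p # w) \<longleftrightarrow> meets (needs (turn s) c p q) w"
    using assms by (cases s) (auto simp: simps dest: drop drop2)
  show "meets (needs s p c q) (q # w) \<longleftrightarrow> meets (needs (advance s) c q p) w"
    using assms by (cases s) (auto simp: simps dest: drop drop2)
qed

lemma meets_arrangements_Cons:
  assumes "p \<noteq> c" "p \<noteq> q" "c \<noteq> q"
  shows "meets (arrangements p c q) (c # w) \<longleftrightarrow> meets (needs One p c q) w"
  using assms by (auto simp: meets_def arrangements_def)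


section \<open>Counting by the number of letter changes\<close>

text \<open>The number of ways to complete a stage by \<open>j\<close> letters, each different from the one before
  it, with completion not earlier than at the last letter.\<close>

fun routes :: "stage \<Rightarrow> nat \<Rightarrow> nat" where
  "routes s 0 = (if s = complete then 1 else 0)"
| "routes s (Suc j) = (if s = complete then 0 else routes (turn s) j + routes (advance s) j)"

text \<open>The number of ways to write \<open>n\<close> as an ordered sum of \<open>j\<close> positive integers, by Pascal's
  recurrence: the first part is 1, or it can be decreased by 1.\<close>

fun compositions :: "nat \<Rightarrow> nat \<Rightarrow> nat" where
  "compositions 0 j = (if j = 0 then 1 else 0)"
| "compositions (Suc n) 0 = 0"
| "compositions (Suc n) (Suc j) = compositions n j + compositions n (Suc j)"

lemma compositions_eq_binomial: "compositions (Suc n) (Suc j) = n choose j"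
proof (induction n arbitrary: j)
  case 0
  then show ?case by (cases j) auto
next
  case (Suc n)
  then show ?case by (cases j) auto
qed

lemma compositions_eq_0: "n < j \<Longrightarrow> compositions n j = 0"
  by (induction n j rule: compositions.induct) auto

text \<open>The \<open>n\<close> remaining letters are cut after each change of letter. Completion happens at a
  change, so this is a composition of \<open>n\<close> into as many parts as there are changes, and a part of
  length \<open>l\<close> consists of \<open>l - 1\<close> repetitions of the current letter and one new letter. The letters
  in their roles do not affect the count, which makes the induction go through.\<close>

lemma card_first_hits_needs:
  assumes "p \<noteq> c" "p \<noteq> q" "c \<noteq> q" "A = {p, c, q}"
  shows "card (first_hits A (meets (needs s p c q)) n) =
    (\<Sum>j\<le>n. compositions n j * routes s j)"
  using assms
proof (induction n arbitrary: s p c q)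
  case 0
  then show ?case by (simp add: card_first_hits_0 meets_needs_Nil)
next
  case (Suc n)
  note letters = Suc.prems
  show ?case
  proof (cases "s = complete")
    case True
    then show ?thesis
      using letters
      by (simp add: card_first_hits_Suc meets_def sum.atMost_Suc_shift del: sum.atMost_Suc)
  next
    case False
    have "card (first_hits A (meets (needs s p c q)) (Suc n)) =
        (\<Sum>a\<in>{p, c, q}. card (first_hits A (\<lambda>w. meets (needs s p c q) (a # w)) n))"
      using letters False by (simp add: card_first_hits_Suc meets_needs_Nil)
    also have "\<dots> = card (first_hits A (meets (needs s p c q)) n)
        + card (first_hits A (meets (needs (turn s) c p q)) n)
        + card (first_hits A (meets (needs (advance s) c q p)) n)"
      using letters by (simp add: meets_needs_Cons)
    also have "\<dots> = (\<Sum>j\<le>n. compositions n j * routes s j)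
        + (\<Sum>j\<le>n. compositions n j * routes (turn s) j)
        + (\<Sum>j\<le>n. compositions n j * routes (advance s) j)"
      using letters Suc.IH[of p c q s] Suc.IH[of c p q "turn s"] Suc.IH[of c q p "advance s"]
      by (simp add: insert_commute)
    \<comment> \<open>The term for \<open>j = Suc n\<close> vanishes, and so does the one for \<open>j = 0\<close>, as \<open>s\<close> is not complete.\<close>
    also have "(\<Sum>j\<le>n. compositions n j * routes s j)
        = (\<Sum>j\<le>Suc n. compositions n j * routes s j)"
      by (simp add: compositions_eq_0)
    also have "\<dots> = (\<Sum>j\<le>n. compositions n (Suc j) * routes s (Suc j))"
      using False by (simp add: sum.atMost_Suc_shift del: sum.atMost_Suc routes.simps(2))
    also have "\<dots> + (\<Sum>j\<le>n. compositions n j * routes (turn s) j)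
        + (\<Sum>j\<le>n. compositions n j * routes (advance s) j)
        = (\<Sum>j\<le>n. compositions (Suc n) (Suc j) * routes s (Suc j))"
      using False by (simp add: sum.distrib[symmetric] algebra_simps)
    also have "\<dots> = (\<Sum>j\<le>Suc n. compositions (Suc n) j * routes s j)"
      by (simp add: sum.atMost_Suc_shift del: sum.atMost_Suc compositions.simps(3) routes.simps(2))
    finally show ?thesis .
  qed
qed

text \<open>The recursion is followed backwards from completion. Its only cycles consist of two letters
  read alternately (\<open>turn\<close>), so each closed form arises by summing earlier ones. It is valid from the
  length on at which the earlier ones are all in their polynomial range, which the nested successors
  express.\<close>

lemma routes_one_gap:
  "routes (Gaps 1 0 0) (Suc j) = 1" "routes (Gaps 0 1 0) (Suc j) = 1"
  "routes (Gaps 0 0 1) (Suc j) = 1"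
proof -
  have *: "routes (Gaps 1 0 0) (Suc j) = 1 \<and> routes (Gaps 0 1 0) (Suc j) = 1" for j
    by (induction j) auto
  show "routes (Gaps 1 0 0) (Suc j) = 1" "routes (Gaps 0 1 0) (Suc j) = 1" using * by auto
  show "routes (Gaps 0 0 1) (Suc j) = 1" using * by (cases j) auto
qed

lemma routes_two_gaps:
  "routes (Gaps 1 0 1) (Suc (Suc j)) = 2" "routes (Gaps 0 1 1) (Suc (Suc j)) = 2"
  using routes_one_gap by (auto simp del: routes.simps simp add: routes.simps(2)[of _ "Suc j"])

lemma routes_three_gaps:
  "routes (Gaps 2 1 0) (Suc j) = j" "routes (Gaps 1 2 0) (Suc j) = j"
proof -
  have "routes (Gaps 2 1 0) (Suc j) = j \<and> routes (Gaps 1 2 0) (Suc j) = j"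
    using routes_one_gap
    by (induction j) (auto simp del: routes.simps(2) simp add: routes.simps(2)[of "Gaps i k l" for i k l])
  then show "routes (Gaps 2 1 0) (Suc j) = j" "routes (Gaps 1 2 0) (Suc j) = j" by auto
qed

lemma routes_early:
  "routes (Gaps 2 1 1) (Suc (Suc (Suc j))) = j + 3"
  "routes (Gaps 2 2 0) (Suc (Suc j)) = 2 * j"
  "routes Third_Early (Suc (Suc (Suc (Suc j)))) = 3 * j + 5"
  "routes Third_Late (Suc (Suc j)) = 2 * j"
proof -
  show A: "routes (Gaps 2 1 1) (Suc (Suc (Suc j))) = j + 3" for j
    using routes_two_gaps(2)[of j] routes_three_gaps(2)[of "Suc j"]
    by (subst routes.simps(2)) (simp add: algebra_simps del: routes.simps)
  show B: "routes (Gaps 2 2 0) (Suc (Suc j)) = 2 * j" for j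
  proof (induction j)
    case 0
    show ?case by (simp add: numeral_2_eq_2)
  next
    case (Suc j)
    then show ?case
      using routes_two_gaps(1)[of j]
      by (subst routes.simps(2)) (simp add: algebra_simps del: routes.simps)
  qed
  show "routes Third_Early (Suc (Suc (Suc (Suc j)))) = 3 * j + 5"
    using A[of j] B[of "Suc j"]
    by (subst routes.simps(2)) (simp add: algebra_simps del: routes.simps)
  show "routes Third_Late (Suc (Suc j)) = 2 * j"
    using routes_three_gaps(1)[of j]
    by (subst routes.simps(2)) (simp add: algebra_simps del: routes.simps)
qed

lemma routes_Two_Repeated: "routes Two_Repeated (Suc (Suc (Suc j))) = j * (j + 1)"
proof (induction j)
  case 0
  show ?case by (simp add: numeral_2_eq_2)
next
  case (Suc j)
  then show ?case
    using routes_early(4)[of "Suc j"]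
    by (subst routes.simps(2)) (simp add: algebra_simps del: routes.simps)
qed

lemma routes_Two_less: "j < 5 \<Longrightarrow> routes Two j = 0"
  by (auto simp: less_Suc_eq eval_nat_numeral)

lemma routes_Two:
  assumes "5 \<le> j"
  shows "int (routes Two j) = (int j - 2)^2 - 2"
proof -
  obtain i where i: "j = Suc (Suc (Suc (Suc (Suc i))))"
    using le_Suc_ex[OF assms] by (auto simp: numeral_eq_Suc)
  show ?thesis
    unfolding i
    using routes_Two_Repeated[of "Suc i"] routes_early(3)[of i]
    by (simp add: routes.simps(2)[of Two] power2_eq_square algebra_simps del: routes.simps)
qed


section \<open>The number of strict superpatterns\<close>

lemma superpattern_mono:
  assumes "superpattern v" "subseq v w" "set w \<subseteq> {1, 2, 3}"
  shows "superpattern w"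
  using assms meets_mono unfolding superpattern_iff_arrangements by blast

lemma strict_superpatterns_eq_first_hits:
  assumes "n > 0"
  shows "{w. length w = n \<and> strict_superpattern w} = first_hits {1, 2, 3} (meets (arrangements 1 2 3)) n"
proof -
  have "\<not> superpattern (butlast w) \<longleftrightarrow> (\<forall>k<n. \<not> meets (arrangements 1 2 3) (take k w))"
    if "length w = n" "set w \<subseteq> {1, 2, 3}" for w
  proof -
    have butlast: "butlast w = take (n - 1) w" using that by (simp add: butlast_conv_take)
    have letters: "set (take k w) \<subseteq> {1, 2, 3}" for k using that set_take_subset by fast
    have "subseq (take k w) (take (n - 1) w)" if "k < n" for k
    proof -
      have "take k w = take k (take (n - 1) w)" using that by simp
      then show ?thesis by (metis prefix_imp_subseq take_is_prefix)
    qed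
    then have "meets (arrangements 1 2 3) (take (n - 1) w)"
      if "meets (arrangements 1 2 3) (take k w)" "k < n" for k
      using that meets_mono by blast
    then show ?thesis
      unfolding superpattern_iff_arrangements butlast using letters \<open>n > 0\<close>
      by (metis diff_less zero_less_one)
  qed
  then show ?thesis
    unfolding strict_superpattern_def first_hits_def
    by (auto simp: superpattern_iff_arrangements)
qed

text \<open>The factor 6 is the choice of the first letter and of the first letter different from it.\<close>

lemma num_strict_superpatterns_eq_sum:
  "num_strict_superpatterns (Suc (Suc n)) = 6 * (\<Sum>j\<le>n. (n choose j) * routes Two j)"
proof -
  let ?A = "{1, 2, 3} :: nat set"
  let ?P = "meets (arrangements 1 2 3) :: nat list \<Rightarrow> bool"
  define N where "N = (\<Sum>j\<le>Suc n. compositions (Suc n) j * routes One j)"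
  have first: "card (first_hits ?A (\<lambda>w. ?P (c # w)) (Suc n)) = N"
    if "arrangements 1 2 3 = arrangements p c q" "?A = {p, c, q}" "p \<noteq> c" "p \<noteq> q" "c \<noteq> q"
    for p c q
    unfolding that(1) N_def meets_arrangements_Cons[OF that(3-5)]
    by (rule card_first_hits_needs[OF that(3-5,2)])
  \<comment> \<open>The letter read first takes the role of \<open>c\<close>; the other two are in symmetric roles.\<close>
  have "card (first_hits ?A (\<lambda>w. ?P (1 # w)) (Suc n)) = N"
    by (rule first[of 2 1 3]) (auto simp: arrangements_def)
  moreover have "card (first_hits ?A (\<lambda>w. ?P (2 # w)) (Suc n)) = N"
    by (rule first[of 1 2 3]) (auto simp: arrangements_def)
  moreover have "card (first_hits ?A (\<lambda>w. ?P (3 # w)) (Suc n)) = N"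
    by (rule first[of 1 3 2]) (auto simp: arrangements_def)
  moreover have "\<not> ?P []" by (simp add: meets_def arrangements_def)
  ultimately have "num_strict_superpatterns (Suc (Suc n)) = 3 * N"
    unfolding num_strict_superpatterns_def strict_superpatterns_eq_first_hits[OF zero_less_Suc]
    by (simp add: card_first_hits_Suc)
  also have "N = (\<Sum>j\<le>n. compositions (Suc n) (Suc j) * routes One (Suc j))"
    unfolding N_def by (simp add: sum.atMost_Suc_shift del: sum.atMost_Suc compositions.simps(3) routes.simps(2))
  also have "3 * \<dots> = 6 * (\<Sum>j\<le>n. (n choose j) * routes Two j)"
    unfolding sum_distrib_left
    by (intro sum.cong) (auto simp: compositions_eq_binomial simp del: compositions.simps)
  finally show ?thesis .
qed

lemma num_strict_superpatterns_formula:
  assumes "n \<ge> 2"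
  shows "int (num_strict_superpatterns n) =
    6 * (\<Sum>m=7..n. ((int m - 4)^2 - 2) * int ((n - 2) choose (m - 2)))"
proof -
  obtain k where n: "n = Suc (Suc k)" using assms by (metis add_2_eq_Suc le_Suc_ex)
  have "int (num_strict_superpatterns n) = 6 * (\<Sum>j\<le>k. int (k choose j) * int (routes Two j))"
    unfolding n num_strict_superpatterns_eq_sum by simp
  also have "(\<Sum>j\<le>k. int (k choose j) * int (routes Two j))
      = (\<Sum>j=5..k. int (k choose j) * int (routes Two j))"
    by (intro sum.mono_neutral_right) (auto simp: routes_Two_less)
  also have "\<dots> = (\<Sum>j=5..k. ((int j - 2)^2 - 2) * int (k choose j))"
    by (intro sum.cong) (auto simp: routes_Two)
  also have "\<dots> = (\<Sum>m=7..n. ((int m - 4)^2 - 2) * int ((n - 2) choose (m - 2)))"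
    by (rule sum.reindex_bij_witness[of _ "\<lambda>m. m - 2" "\<lambda>j. j + 2"]) (auto simp: n)
  finally show ?thesis .
qed

text \<open>The shortest prefix that is a superpattern is strict, but for lengths below 7 the sum
  counting the strict superpatterns is empty.\<close>

lemma superpattern_length_ge_7:
  assumes "superpattern w"
  shows "length w \<ge> 7"
proof (rule ccontr)
  assume short: "\<not> length w \<ge> 7"
  define k where "k = (LEAST k. superpattern (take k w))"
  have "superpattern (take (length w) w)" using assms by simp
  then have k: "superpattern (take k w)" "k \<le> length w"
    unfolding k_def by (rule LeastI, rule Least_le)
  have "\<not> superpattern []" by (simp add: superpattern_iff_arrangements meets_def arrangements_def)
  then have "k > 0" using k(1) by (cases k) auto
  have "butlast (take k w) = take (k - 1) w"
    using k(2) by (rule butlast_take)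
  moreover have "\<not> superpattern (take (k - 1) w)"
    using not_less_Least[of "k - 1" "\<lambda>k. superpattern (take k w)"] \<open>k > 0\<close> by (simp add: k_def)
  ultimately have strict: "take k w \<in> {w. length w = k \<and> strict_superpattern w}"
    using k by (simp add: strict_superpattern_def)
  have "finite {w. length w = k \<and> strict_superpattern w}"
    using \<open>k > 0\<close> by (simp add: strict_superpatterns_eq_first_hits finite_first_hits)
  then have "num_strict_superpatterns k > 0"
    unfolding num_strict_superpatterns_def using strict card_gt_0_iff by blast
  moreover have "num_strict_superpatterns k = 0"
  proof (cases "k \<ge> 2")
    case True
    then show ?thesis using num_strict_superpatterns_formula[OF True] short k(2) by simp
  next
    case False
    then have "k = 1" using \<open>k > 0\<close> by simp
    have "\<not> superpattern u" if "length u = 1" for u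
      using that by (auto simp: superpattern_iff_arrangements meets_def arrangements_def length_Suc_conv)
    then have "{w. length w = k \<and> strict_superpattern w} = {}"
      unfolding \<open>k = 1\<close> strict_superpattern_def by blast
    then show ?thesis by (simp only: num_strict_superpatterns_def card.empty)
  qed
  ultimately show False by simp
qed


section \<open>The waiting time\<close>

lemma Inf_enat_image_eq_Least:
  assumes "k \<in> T"
  shows "(INF t\<in>T. enat t) = enat (LEAST t. t \<in> T)"
proof (rule antisym)
  show "(INF t\<in>T. enat t) \<le> enat (LEAST t. t \<in> T)"
    using assms by (intro INF_lower LeastI)
  show "enat (LEAST t. t \<in> T) \<le> (INF t\<in>T. enat t)"
    by (intro INF_greatest) (simp add: Least_le)
qed

lemma waiting_time_eq_iff_strict:
  assumes "n \<ge> 7"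
  shows "waiting_time X \<omega> = enat n \<longleftrightarrow> strict_superpattern (map (\<lambda>i. X i \<omega>) [1..<Suc n])"
proof -
  define pre where "pre t = map (\<lambda>i. X i \<omega>) [1..<Suc t]" for t
  define T where "T = {t. t \<ge> 7 \<and> superpattern (pre t)}"
  \<comment> \<open>For \<open>n = 7\<close> it must be known that the prefix of length 6 fails, although 6 is below the
    bound in \<open>T\<close>.\<close>
  have T: "t \<in> T \<longleftrightarrow> superpattern (pre t)" for t
    using superpattern_length_ge_7[of "pre t"] by (auto simp: T_def pre_def)
  have wait: "waiting_time X \<omega> = (INF t\<in>T. enat t)"
    by (simp add: waiting_time_def T_def pre_def)
  have "pre n = pre (n - 1) @ [X n \<omega>]"
    using assms by (cases n) (auto simp: pre_def)
  then have butlast: "butlast (pre n) = pre (n - 1)" by simp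
  have mono: "superpattern (pre s)" if "superpattern (pre t)" "t \<le> s" "superpattern (pre n)" "s \<le> n" for s t
  proof (rule superpattern_mono[OF that(1)])
    have "[1..<Suc s] = [1..<Suc t] @ [Suc t..<Suc s]"
      using that(2) upt_add_eq_append[of 1 "Suc t" "s - t"] by simp
    then have "pre s = pre t @ map (\<lambda>i. X i \<omega>) [Suc t..<Suc s]"
      by (simp add: pre_def del: upt_Suc)
    then show "subseq (pre t) (pre s)" by (metis prefixI prefix_imp_subseq)
    have "set (pre s) \<subseteq> set (pre n)" using that(4) by (auto simp: pre_def)
    then show "set (pre s) \<subseteq> {1, 2, 3}" using that(3) unfolding superpattern_def by blast
  qed
  have "(INF t\<in>T. enat t) = enat n \<longleftrightarrow> n \<in> T \<and> n - 1 \<notin> T"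
  proof
    assume eq: "(INF t\<in>T. enat t) = enat n"
    then have "T \<noteq> {}" by (auto simp: top_enat_def)
    then obtain k where "k \<in> T" by blast
    then have "n = (LEAST t. t \<in> T)" using eq Inf_enat_image_eq_Least[of k T] by simp
    then show "n \<in> T \<and> n - 1 \<notin> T"
      using LeastI[of "\<lambda>t. t \<in> T" k] not_less_Least[of "n - 1" "\<lambda>t. t \<in> T"] \<open>k \<in> T\<close> assms
      by auto
  next
    assume n: "n \<in> T \<and> n - 1 \<notin> T"
    have "(LEAST t. t \<in> T) = n"
    proof (rule Least_equality)
      show "n \<in> T" using n by simp
      fix t assume "t \<in> T"
      show "n \<le> t"
      proof (rule ccontr)
        assume "\<not> n \<le> t"
        then have "t \<le> n - 1" by linarith
        then have "n - 1 \<in> T" using mono[of t "n - 1"] \<open>t \<in> T\<close> n by (simp add: T)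
        with n show False by simp
      qed
    qed
    then show "(INF t\<in>T. enat t) = enat n" using Inf_enat_image_eq_Least[of n T] n by simp
  qed
  then show ?thesis
    unfolding wait T butlast[symmetric] by (simp add: strict_superpattern_def pre_def)
qed

lemma (in prob_space) prob_word:
  assumes indep: "indep_vars (\<lambda>_. count_space UNIV) X {1..}"
    and unif: "\<And>i. i \<ge> 1 \<Longrightarrow> distr M (count_space UNIV) (X i) = measure_pmf (pmf_of_set A)"
    and A: "finite A" "A \<noteq> {}"
    and w: "set w \<subseteq> A"
  shows "{\<omega> \<in> space M. map (\<lambda>i. X i \<omega>) [1..<Suc (length w)] = w} \<in> events"
    and "prob {\<omega> \<in> space M. map (\<lambda>i. X i \<omega>) [1..<Suc (length w)] = w} = (1 / card A) ^ length w"
proof -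
  have meas: "X i \<in> measurable M (count_space UNIV)" if "i \<ge> 1" for i
    using indep that unfolding indep_vars_def2 by auto
  let ?E = "\<lambda>i. X i -` {w ! (i - 1)} \<inter> space M"
  have ev: "?E i \<in> events" if "i \<ge> 1" for i
    using meas[OF that] by (rule measurable_sets) simp
  have letter: "prob (?E i) = 1 / card A" if "i \<in> {1..length w}" for i
  proof -
    have "prob (?E i) = measure (distr M (count_space UNIV) (X i)) {w ! (i - 1)}"
      using meas that by (subst measure_distr) auto
    also have "\<dots> = pmf (pmf_of_set A) (w ! (i - 1))"
      using unif that by (simp add: pmf.rep_eq)
    also have "w ! (i - 1) \<in> A"
      using w that nth_mem[of "i - 1" w] by auto
    then have "pmf (pmf_of_set A) (w ! (i - 1)) = 1 / card A"
      using A by simp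
    finally show ?thesis .
  qed
  have eq: "{\<omega> \<in> space M. map (\<lambda>i. X i \<omega>) [1..<Suc (length w)] = w}
      = {\<omega> \<in> space M. \<forall>i\<in>{1..length w}. \<omega> \<in> ?E i}"
  proof -
    have "map (\<lambda>i. X i \<omega>) [1..<Suc (length w)] = w \<longleftrightarrow> (\<forall>i\<in>{1..length w}. X i \<omega> = w ! (i - 1))" for \<omega>
    proof
      assume L: "map (\<lambda>i. X i \<omega>) [1..<Suc (length w)] = w"
      show "\<forall>i\<in>{1..length w}. X i \<omega> = w ! (i - 1)"
      proof
        fix i assume i: "i \<in> {1..length w}"
        have "map (\<lambda>i. X i \<omega>) [1..<Suc (length w)] ! (i - 1) = X i \<omega>"
          using i by (subst nth_map) (auto simp del: upt_Suc)
        then show "X i \<omega> = w ! (i - 1)" unfolding L by simp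
      qed
    next
      assume "\<forall>i\<in>{1..length w}. X i \<omega> = w ! (i - 1)"
      then show "map (\<lambda>i. X i \<omega>) [1..<Suc (length w)] = w"
        by (intro nth_equalityI) (auto simp del: upt_Suc)
    qed
    then show ?thesis by auto
  qed
  show "{\<omega> \<in> space M. map (\<lambda>i. X i \<omega>) [1..<Suc (length w)] = w} \<in> events"
    unfolding eq using ev by (intro sets.sets_Collect_finite_All) (auto simp: Int_def vimage_def conj_commute)
  show "prob {\<omega> \<in> space M. map (\<lambda>i. X i \<omega>) [1..<Suc (length w)] = w} = (1 / card A) ^ length w"
  proof (cases "w = []")
    case True
    then show ?thesis by (simp add: prob_space)
  next
    case False
    then have ne: "{1..length w} \<noteq> {}" by (cases w) auto
    then have "{\<omega> \<in> space M. \<forall>i\<in>{1..length w}. \<omega> \<in> ?E i} = (\<Inter>i\<in>{1..length w}. ?E i)"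
      by auto
    moreover have "prob (\<Inter>i\<in>{1..length w}. ?E i) = (\<Prod>i\<in>{1..length w}. prob (?E i))"
      using ne by (intro indep_varsD[OF indep]) auto
    moreover have "\<dots> = (1 / card A) ^ length w"
      using letter by simp
    ultimately show ?thesis unfolding eq by simp
  qed
qed

lemma (in prob_space) prob_waiting_time:
  assumes indep: "indep_vars (\<lambda>_. count_space UNIV) X {1..}"
    and unif: "\<And>i. i \<ge> 1 \<Longrightarrow> distr M (count_space UNIV) (X i) = measure_pmf (pmf_of_set {1,2,3})"
    and n: "n \<ge> 7"
  shows "\<P>(\<omega> in M. waiting_time X \<omega> = enat n) = num_strict_superpatterns n / 3 ^ n"
proof -
  define S where "S = {w. length w = n \<and> strict_superpattern w}"
  define E where "E w = {\<omega> \<in> space M. map (\<lambda>i. X i \<omega>) [1..<Suc (length w)] = w}" for w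
  have fin: "finite S"
    using n unfolding S_def by (simp add: strict_superpatterns_eq_first_hits finite_first_hits)
  have S: "length w = n" "set w \<subseteq> {1, 2, 3}" if "w \<in> S" for w
    using that by (auto simp: S_def strict_superpattern_def superpattern_def)
  have ev: "E w \<in> events" and pr: "prob (E w) = (1 / 3) ^ n" if "w \<in> S" for w
    using prob_word[OF indep unif _ _ S(2)[OF that]] S(1)[OF that] by (auto simp: E_def)
  have "{\<omega> \<in> space M. waiting_time X \<omega> = enat n} = (\<Union>w\<in>S. E w)"
    unfolding waiting_time_eq_iff_strict[OF n] by (auto simp: S_def E_def)
  moreover have "disjoint_family_on E S"
    unfolding disjoint_family_on_def
  proof (intro ballI impI)
    fix v w assume "v \<in> S" "w \<in> S" "v \<noteq> w"
    then show "E v \<inter> E w = {}"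
      using S(1)[of v] S(1)[of w] by (auto simp: E_def simp del: upt_Suc)
  qed
  then have "prob (\<Union>w\<in>S. E w) = (\<Sum>w\<in>S. prob (E w))"
    using fin ev
    by (intro finite_measure_finite_Union) auto
  moreover have "\<dots> = num_strict_superpatterns n / 3 ^ n"
    using pr by (simp add: num_strict_superpatterns_def S_def power_one_over)
  ultimately show ?thesis by simp
qed

theorem theorem3p8:
  shows "(\<forall>n\<ge>7. int (num_strict_superpatterns n) =
            6 * (\<Sum>m=7..n. ((int m - 4)^2 - 2) * int ((n - 2) choose (m - 2)))) \<and>
         (\<forall>(M :: 'a measure) (X :: nat \<Rightarrow> 'a \<Rightarrow> nat).
            prob_space M \<longrightarrow>
            prob_space.indep_vars M (\<lambda>_. count_space UNIV) X {1..} \<longrightarrow>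
            (\<forall>i\<ge>1. distr M (count_space UNIV) (X i) = measure_pmf (pmf_of_set {1,2,3})) \<longrightarrow>
            (\<forall>n\<ge>7. \<P>(\<omega> in M. waiting_time X \<omega> = enat n) =
               6 / 3 ^ n * (\<Sum>m=7..n. ((real m - 4)^2 - 2) * real ((n - 2) choose (m - 2)))))"
proof (intro conjI allI impI)
  fix n :: nat assume "n \<ge> 7"
  then show "int (num_strict_superpatterns n) =
      6 * (\<Sum>m=7..n. ((int m - 4)^2 - 2) * int ((n - 2) choose (m - 2)))"
    by (intro num_strict_superpatterns_formula) simp
next
  fix M :: "'a measure" and X :: "nat \<Rightarrow> 'a \<Rightarrow> nat" and n :: nat
  assume ps: "prob_space M" and indep: "prob_space.indep_vars M (\<lambda>_. count_space UNIV) X {1..}"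
    and unif: "\<forall>i\<ge>1. distr M (count_space UNIV) (X i) = measure_pmf (pmf_of_set {1,2,3})"
    and n: "n \<ge> 7"
  have "real (num_strict_superpatterns n) = real_of_int (int (num_strict_superpatterns n))"
    by simp
  also have "\<dots> = 6 * (\<Sum>m=7..n. ((real m - 4)^2 - 2) * real ((n - 2) choose (m - 2)))"
    using n by (subst num_strict_superpatterns_formula) simp_all
  finally show "\<P>(\<omega> in M. waiting_time X \<omega> = enat n) =
      6 / 3 ^ n * (\<Sum>m=7..n. ((real m - 4)^2 - 2) * real ((n - 2) choose (m - 2)))"
    using prob_space.prob_waiting_time[OF ps indep _ n] unif by simp
qed

end
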